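(* Let $f\in F(n)$ have at least one fixed point. Then there exists $h\in F(n)$ with $h\sim f$ such that, from every configuration $x\in\{0,1\}^n$, $\mathcal{A}(h)$ has an almost decreasing path from $x$ to some fixed point of $h$.
   Context: $F(n)$ is the set of all functions $f:\{0,1\}^n\to\{0,1\}^n$, written $f=(f_1,\dots,f_n)$. $e_i$ is the configuration with a $1$ exactly in component $i$; addition is componentwise modulo $2$. The asynchronous graph $\mathcal{A}(f)$ is the digraph on $\{0,1\}^n$ with an arc from $x$ to $x+e_i$ whenever $f_i(x)\neq x_i$. $\leq$ denotes the componentwise partial order on $\{0,1\}^n$. An arc from $x$ to $y$ in $\mathcal{A}(h)$ is increasing if $x<y$ and decreasing otherwise. A path is almost decreasing if all its arcs, except possibly one, are decreasing (paths of length $0$ are allowed). $\mathcal{S}(f)$ has an arc $x\to f(x)$; $f\sim h$ means $\mathcal{S}(f)$ and $\mathcal{S}(h)$ are isomorphic. *)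

theory Defs
  imports "Graph_Theory.Graph_Theory" "HOL-Library.FuncSet"
begin

text \<open>Configurations are extensional functions on \<open>{1..n}\<close>: all of them take the same value
  \<open>undefined\<close> outside \<open>{1..n}\<close>, so on configurations the pointwise order \<open>\<le>\<close> of the function
  type is the componentwise order of \<open>{0,1}\<^sup>n\<close>.\<close>

type_synonym conf = "nat \<Rightarrow> nat"

definition confs :: "nat \<Rightarrow> conf set" where
  "confs n = {1..n} \<rightarrow>\<^sub>E {0, 1}"

definition F :: "nat \<Rightarrow> (conf \<Rightarrow> conf) set" where
  "F n = confs n \<rightarrow>\<^sub>E confs n"

definition unit_conf :: "nat \<Rightarrow> nat \<Rightarrow> conf" where
  "unit_conf n i = (\<lambda>j\<in>{1..n}. if j = i then 1 else 0)"

definition add_conf :: "nat \<Rightarrow> conf \<Rightarrow> conf \<Rightarrow> conf" where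
  "add_conf n x y = (\<lambda>j\<in>{1..n}. (x j + y j) mod 2)"

definition fixed_points :: "nat \<Rightarrow> (conf \<Rightarrow> conf) \<Rightarrow> conf set" where
  "fixed_points n f = {x \<in> confs n. f x = x}"

definition async_graph :: "nat \<Rightarrow> (conf \<Rightarrow> conf) \<Rightarrow> (conf, conf \<times> conf) pre_digraph" where
  "async_graph n f = with_proj
     \<lparr> pverts = confs n,
       parcs = {(x, add_conf n x (unit_conf n i)) | x i. x \<in> confs n \<and> i \<in> {1..n} \<and> f x i \<noteq> x i} \<rparr>"

definition sync_graph :: "nat \<Rightarrow> (conf \<Rightarrow> conf) \<Rightarrow> (conf, conf \<times> conf) pre_digraph" where
  "sync_graph n f = with_proj \<lparr> pverts = confs n, parcs = {(x, f x) | x. x \<in> confs n} \<rparr>"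

definition dyn_iso :: "nat \<Rightarrow> (conf \<Rightarrow> conf) \<Rightarrow> (conf \<Rightarrow> conf) \<Rightarrow> bool" where
  "dyn_iso n f h \<longleftrightarrow> digraph_iso (sync_graph n f) (sync_graph n h)"

definition increasing_arc :: "conf \<times> conf \<Rightarrow> bool" where
  "increasing_arc a \<longleftrightarrow> fst a < snd a"

definition decreasing_arc :: "conf \<times> conf \<Rightarrow> bool" where
  "decreasing_arc a \<longleftrightarrow> \<not> increasing_arc a"

definition almost_decreasing :: "(conf \<times> conf) list \<Rightarrow> bool" where
  "almost_decreasing p \<longleftrightarrow> length (filter (\<lambda>a. \<not> decreasing_arc a) p) \<le> 1"

end

theory Submission
  imports Defs "HOL-Combinatorics.Transposition"
begin

text \<open>
  A conjugate of \<open>f\<close> is given by a bijective labelling \<open>\<pi>\<close> of the configurations. A configuration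
  labelled \<open>y\<close> whose image is labelled \<open>z\<close> has a decreasing arc unless \<open>y \<le> z\<close>, so a labelling without
  such ascents (except at fixed points) gives decreasing paths to fixed points. Labels are handed out
  by increasing weight, starting with a fixed point. A point placed after its image is never an
  ascent. A cycle is placed backwards along \<open>f\<close>, so that only its first point can be an ascent, and
  this is repaired by moving the label of the last point to another one of the same weight, which is
  possible as long as the all-ones label is unused. If \<open>f\<close> is not surjective, or has a second fixed
  point and is bijective, some point can be reserved for the all-ones label.

  Otherwise \<open>f\<close> is a permutation with a single fixed point, and by parity it has a cycle of length at
  least 3. This cycle is placed last, with the all-ones label at a point \<open>t\<close> and the label \<open>\<beta>\<close> of the
  preimage of \<open>t\<close> having weight \<open>n - 1\<close>. Then \<open>\<beta>\<close> is the only ascent. It is avoided by every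
  decreasing path that starts elsewhere (from the all-ones configuration, by a suitable first arc),
  and from \<open>\<beta>\<close> itself one increasing arc leads to such a start.
\<close>

section \<open>Configurations, their weights and the componentwise order\<close>

definition weight :: "nat \<Rightarrow> conf \<Rightarrow> nat" where
  "weight n x = (\<Sum>i\<in>{1..n}. x i)"

lemma finite_confs: "finite (confs n)"
  unfolding confs_def by (intro finite_PiE) auto

lemma card_confs: "card (confs n) = 2 ^ n"
  unfolding confs_def by (simp add: card_PiE numeral_2_eq_2)

lemma confs_cases: "x \<in> confs n \<Longrightarrow> i \<in> {1..n} \<Longrightarrow> x i = 0 \<or> x i = 1"
  unfolding confs_def by (auto dest!: PiE_mem)

lemma confs_outside: "x \<in> confs n \<Longrightarrow> i \<notin> {1..n} \<Longrightarrow> x i = undefined"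
  unfolding confs_def by (rule PiE_arb)

lemma confs_eqI:
  "x \<in> confs n \<Longrightarrow> y \<in> confs n \<Longrightarrow> (\<And>i. i \<in> {1..n} \<Longrightarrow> x i = y i) \<Longrightarrow> x = y"
  unfolding confs_def by (rule PiE_ext) auto

lemma confs_leI:
  assumes "x \<in> confs n" "y \<in> confs n" "\<And>i. i \<in> {1..n} \<Longrightarrow> x i \<le> y i"
  shows "x \<le> y"
proof (rule le_funI)
  fix i show "x i \<le> y i"
  proof (cases "i \<in> {1..n}")
    case False
    then have "x i = undefined" "y i = undefined"
      using assms(1,2) confs_outside by blast+
    then show ?thesis by simp
  qed (simp add: assms(3))
qed

lemma confs_not_leE:
  assumes "x \<in> confs n" "y \<in> confs n" "\<not> x \<le> y"
  obtains i where "i \<in> {1..n}" "x i = 1" "y i = 0"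
proof -
  obtain i where i: "i \<in> {1..n}" "\<not> x i \<le> y i"
    using confs_leI[OF assms(1,2)] assms(3) by blast
  then show ?thesis
    using that confs_cases[OF assms(1) i(1)] confs_cases[OF assms(2) i(1)] by auto
qed

lemma weight_strict_mono:
  assumes "x \<in> confs n" "y \<in> confs n" "x \<le> y" "x \<noteq> y"
  shows "weight n x < weight n y"
proof -
  obtain i where i: "i \<in> {1..n}" "x i \<noteq> y i"
    using confs_eqI assms by blast
  have "x i < y i" using le_funD[OF assms(3), of i] i by simp
  then show ?thesis unfolding weight_def
    using i(1) assms(3) by (intro sum_strict_mono_ex1) (auto dest: le_funD)
qed

text \<open>Distinct comparable configurations differ in weight; this is how labels handed out by
  increasing weight rule out ascents.\<close>

lemma not_le_if_weight_le:
  assumes "x \<in> confs n" "y \<in> confs n" "weight n y \<le> weight n x" "x \<noteq> y"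
  shows "\<not> x \<le> y"
  using weight_strict_mono[of x n y] assms by auto

definition ones :: "nat \<Rightarrow> conf" where
  "ones n = (\<lambda>i\<in>{1..n}. 1)"

lemma ones_in_confs: "ones n \<in> confs n"
  unfolding ones_def confs_def by auto

lemma le_ones: "x \<in> confs n \<Longrightarrow> x \<le> ones n"
  by (rule confs_leI[OF _ ones_in_confs]) (auto simp: ones_def dest: confs_cases)

lemma weight_ones: "weight n (ones n) = n"
  by (simp add: weight_def ones_def)

lemma fun_upd_in_confs: "x \<in> confs n \<Longrightarrow> i \<in> {1..n} \<Longrightarrow> a \<in> {0, 1} \<Longrightarrow> x(i := a) \<in> confs n"
  unfolding confs_def by (simp add: PiE_iff extensional_def)

lemma weight_fun_upd_0:
  assumes "i \<in> {1..n}" "x i = 1"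
  shows "Suc (weight n (x(i := 0))) = weight n x"
proof -
  have "weight n x = x i + (\<Sum>j\<in>{1..n}-{i}. x j)"
    unfolding weight_def using assms(1) by (intro sum.remove) auto
  moreover have "weight n (x(i := 0)) = 0 + (\<Sum>j\<in>{1..n}-{i}. (x(i := 0)) j)"
    unfolding weight_def using assms(1) by (subst sum.remove[of _ i]) auto
  moreover have "(\<Sum>j\<in>{1..n}-{i}. (x(i := 0)) j) = (\<Sum>j\<in>{1..n}-{i}. x j)"
    by (rule sum.cong) auto
  ultimately show ?thesis using assms(2) by simp
qed

text \<open>Swapping coordinates \<open>i\<close> and \<open>j\<close> keeps the weight of
  \<open>v\<close> and puts a 0 where \<open>u\<close> has a 1.\<close>

lemma same_weight_not_above:
  assumes u: "u \<in> confs n" "i \<in> {1..n}" "u i = 1"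
    and v: "v \<in> confs n" "j \<in> {1..n}" "v j = 0"
  shows "\<exists>v'\<in>confs n. weight n v' = weight n v \<and> \<not> u \<le> v'"
proof
  let ?v = "v \<circ> transpose i j"
  show "?v \<in> confs n"
    using u(2) v(1,2) unfolding confs_def by (auto simp: PiE_iff extensional_def transpose_def)
  have "bij_betw (transpose i j) {1..n} {1..n}"
    using u(2) v(2) by (simp add: bij_betw_transpose_iff)
  then have "weight n ?v = weight n v"
    unfolding weight_def using sum.reindex_bij_betw[of "transpose i j" "{1..n}" "{1..n}" v] by simp
  moreover have "\<not> u \<le> ?v" using u(3) v(3) by (auto simp: le_fun_def intro: exI[of _ i])
  ultimately show "weight n ?v = weight n v \<and> \<not> u \<le> ?v" ..
qed

section \<open>Handing out labels by increasing weight\<close>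

text \<open>An initial segment of the configurations sorted by weight. The order inside a weight
  level stays free, which \<open>cyclic_labels\<close> exploits.\<close>

definition lower :: "nat \<Rightarrow> conf set \<Rightarrow> bool" where
  "lower n Y \<longleftrightarrow> Y \<subseteq> confs n \<and> (\<forall>y\<in>Y. \<forall>z\<in>confs n - Y. weight n y \<le> weight n z)"

lemma lower_insert:
  assumes "lower n Y" "Y \<noteq> confs n"
  obtains z where "z \<in> confs n - Y" "lower n (insert z Y)"
proof -
  have ne: "confs n - Y \<noteq> {}" using assms unfolding lower_def by auto
  define z where "z = arg_min_on (weight n) (confs n - Y)"
  have z: "z \<in> confs n - Y" "\<And>x. x \<in> confs n - Y \<Longrightarrow> weight n z \<le> weight n x"
    unfolding z_def using arg_min_if_finite(1)[OF _ ne] arg_min_least[OF _ ne]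
    by (simp_all add: finite_confs)
  then have "lower n (insert z Y)" using assms(1) unfolding lower_def by auto
  with z that show thesis by blast
qed

lemma ascending_labels:
  assumes "lower n Y" "card Y + k \<le> card (confs n)"
  shows "\<exists>y. inj_on y {..<k} \<and> y ` {..<k} \<subseteq> confs n - Y \<and>
    (\<forall>i j. i \<le> j \<longrightarrow> j < k \<longrightarrow> weight n (y i) \<le> weight n (y j)) \<and> lower n (Y \<union> y ` {..<k})"
  using assms(2)
proof (induction k)
  case 0
  then show ?case using assms(1) by auto
next
  case (Suc k)
  then obtain y where y: "inj_on y {..<k}" "y ` {..<k} \<subseteq> confs n - Y"
    "\<And>i j. i \<le> j \<Longrightarrow> j < k \<Longrightarrow> weight n (y i) \<le> weight n (y j)" "lower n (Y \<union> y ` {..<k})"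
    by (metis Suc_leD add_Suc_right)
  have "card (Y \<union> y ` {..<k}) \<le> card Y + k"
    using card_Un_le[of Y "y ` {..<k}"] card_image_le[of "{..<k}" y] by simp
  then have "Y \<union> y ` {..<k} \<noteq> confs n" using Suc.prems by auto
  then obtain z where z: "z \<in> confs n - (Y \<union> y ` {..<k})" "lower n (insert z (Y \<union> y ` {..<k}))"
    using lower_insert[OF y(4)] by metis
  define y' where "y' = y(k := z)"
  have y'_eq: "y' i = y i" if "i < k" for i using that by (simp add: y'_def)
  have im: "y' ` {..<Suc k} = insert z (y ` {..<k})"
    by (auto simp: y'_def lessThan_Suc)
  have "inj_on y' {..<Suc k}"
    using y(1) z(1) unfolding y'_def lessThan_Suc by (auto simp: inj_on_def)
  moreover have "y' ` {..<Suc k} \<subseteq> confs n - Y" using im y(2) z(1) by auto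
  moreover have "weight n (y' i) \<le> weight n (y' j)" if ij: "i \<le> j" "j < Suc k" for i j
  proof (cases "j = k \<and> i \<noteq> k")
    case True
    then have "i < k" using ij by simp
    then have "weight n (y i) \<le> weight n z" using y(4) z(1) unfolding lower_def by blast
    then show ?thesis using True \<open>i < k\<close> by (simp add: y'_def)
  next
    case False
    then show ?thesis using ij y(3)[of i j] y'_eq[of i] y'_eq[of j]
      by (cases "j = k") auto
  qed
  moreover have "lower n (Y \<union> y' ` {..<Suc k})" using im z(2) by simp
  ultimately show ?case by blast
qed

lemma cyclic_labels:
  assumes Y: "lower n Y" "Y \<noteq> {}" and k: "2 \<le> k" "card Y + k < card (confs n)"
  shows "\<exists>y. inj_on y {..<k} \<and> y ` {..<k} \<subseteq> confs n - Y \<and>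
    (\<forall>i j. i \<le> j \<longrightarrow> j < k \<longrightarrow> weight n (y i) \<le> weight n (y j)) \<and> lower n (Y \<union> y ` {..<k}) \<and>
    \<not> y 0 \<le> y (k - 1)"
proof -
  obtain y where y: "inj_on y {..<k}" "y ` {..<k} \<subseteq> confs n - Y"
    "\<And>i j. i \<le> j \<Longrightarrow> j < k \<Longrightarrow> weight n (y i) \<le> weight n (y j)" "lower n (Y \<union> y ` {..<k})"
    using ascending_labels[OF Y(1), of k] k by auto
  define u v where "u = y 0" and "v = y (k - 1)"
  have u: "u \<in> confs n - Y" and v: "v \<in> confs n - Y" using y(2) k by (auto simp: u_def v_def image_subset_iff)
  show ?thesis
  proof (cases "u \<le> v")
    case False
    then show ?thesis using y unfolding u_def v_def by (intro exI[of _ y]) auto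
  next
    case True
    have "u \<noteq> v" using inj_onD[OF y(1), of 0 "k - 1"] k by (auto simp: u_def v_def)
    then have wuv: "weight n u < weight n v" using weight_strict_mono True u v by blast
    obtain y0 where y0: "y0 \<in> Y" using Y(2) by blast
    then have y0c: "y0 \<in> confs n" using Y(1) unfolding lower_def by auto
    have "weight n y0 \<le> weight n u" "u \<noteq> y0" using Y(1) u y0 unfolding lower_def by auto
    then obtain i where i: "i \<in> {1..n}" "u i = 1"
      using not_le_if_weight_le[of u n y0] confs_not_leE[of u n y0] u y0c by auto
    have "card (Y \<union> y ` {..<k}) \<le> card Y + k"
      using card_Un_le[of Y "y ` {..<k}"] card_image_le[of "{..<k}" y] by simp
    then have "Y \<union> y ` {..<k} \<noteq> confs n" using k by auto
    then obtain z where z: "z \<in> confs n" "z \<notin> Y \<union> y ` {..<k}" using y(4) unfolding lower_def by auto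
    have "v \<in> Y \<union> y ` {..<k}" using k by (auto simp: v_def)
    then have "weight n v \<le> weight n z" "z \<noteq> v" using y(4) z unfolding lower_def by auto
    then obtain j where j: "j \<in> {1..n}" "v j = 0"
      using not_le_if_weight_le[of z n v] confs_not_leE[of z n v] v z by auto
    obtain v' where v': "v' \<in> confs n" "weight n v' = weight n v" "\<not> u \<le> v'"
      using same_weight_not_above[of u n i v j] u v i j by auto
    \<comment> \<open>\<open>v'\<close> is strictly heavier than \<open>u\<close>, hence than all of
      \<open>Y\<close>, so the exchange leaves \<open>Y\<close> alone.\<close>
    have "weight n a \<le> weight n u" if "a \<in> Y" for a using Y(1) u that unfolding lower_def by blast
    then have v'Y: "v' \<notin> Y" using v'(2) wuv by fastforce
    \<comment> \<open>\<open>v'\<close> may or may not already be one of the labels; the transposition covers both cases.\<close>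
    let ?t = "transpose v v'"
    have wt: "weight n (?t a) = weight n a" for a using v'(2) by (simp add: transpose_def)
    have tc: "?t a \<in> confs n \<longleftrightarrow> a \<in> confs n" for a using v v' by (auto simp: transpose_def)
    have tY: "?t a \<in> Y \<longleftrightarrow> a \<in> Y" for a using v v'Y by (auto simp: transpose_def)
    have t0: "?t (y 0) = u" using wuv v' u_def by (auto simp: transpose_def)
    have t1: "?t (y (k - 1)) = v'" by (simp add: v_def)
    let ?Z = "Y \<union> y ` {..<k}"
    have im: "a \<in> Y \<union> (?t \<circ> y) ` {..<k} \<longleftrightarrow> ?t a \<in> ?Z" for a
    proof -
      have "a \<in> ?t ` B \<longleftrightarrow> ?t a \<in> B" for B
        by (auto intro: image_eqI[of a ?t "?t a"])
      then have "a \<in> (?t \<circ> y) ` {..<k} \<longleftrightarrow> ?t a \<in> y ` {..<k}"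
        unfolding image_comp[symmetric] .
      then show ?thesis using tY by blast
    qed
    \<comment> \<open>The exchange preserves weights, so \<open>lower\<close> carries over from the
      old set of labels.\<close>
    have "lower n (Y \<union> (?t \<circ> y) ` {..<k})"
      unfolding lower_def
    proof (intro conjI ballI subsetI)
      fix a assume "a \<in> Y \<union> (?t \<circ> y) ` {..<k}"
      then have a: "?t a \<in> ?Z" using im by blast
      then show "a \<in> confs n" using y(4) tc unfolding lower_def by blast
      fix b assume "b \<in> confs n - (Y \<union> (?t \<circ> y) ` {..<k})"
      then have "?t b \<in> confs n - ?Z" using im tc by blast
      then have "weight n (?t a) \<le> weight n (?t b)" using a y(4) unfolding lower_def by blast
      then show "weight n a \<le> weight n b" by (simp only: wt)
    qed
    moreover have "inj_on (?t \<circ> y) {..<k}"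
      using y(1) by (intro comp_inj_on) (auto intro: inj_on_subset[OF inj_transpose])
    moreover have "(?t \<circ> y) ` {..<k} \<subseteq> confs n - Y"
      using y(2) tc tY by auto
    ultimately show ?thesis
      using y(3) v'(3) wt t0 t1 by (intro exI[of _ "?t \<circ> y"]) simp
  qed
qed

section \<open>Partial labellings and their extensions\<close>

definition labelling :: "nat \<Rightarrow> conf set \<Rightarrow> (conf \<Rightarrow> conf) \<Rightarrow> bool" where
  "labelling n X \<pi> \<longleftrightarrow> inj_on \<pi> X \<and> lower n (\<pi> ` X)"

lemma labelling_in_confs: "labelling n X \<pi> \<Longrightarrow> x \<in> X \<Longrightarrow> \<pi> x \<in> confs n"
  unfolding labelling_def lower_def by auto

lemma labelling_bij:
  assumes "labelling n (confs n) \<pi>"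
  shows "bij_betw \<pi> (confs n) (confs n)"
  using assms endo_inj_surj[OF finite_confs] unfolding labelling_def lower_def bij_betw_def by auto

lemma extend_labelling_point:
  assumes X: "X \<subseteq> confs n" "labelling n X \<pi>" and x: "x \<in> confs n - X"
  shows "\<exists>\<pi>'. labelling n (insert x X) \<pi>' \<and> (\<forall>z\<in>X. \<pi>' z = \<pi> z) \<and> (\<forall>z\<in>X. \<not> \<pi>' x \<le> \<pi>' z)"
proof -
  have "card X < card (confs n)" using X(1) x finite_confs by (intro psubset_card_mono) auto
  then have "\<pi> ` X \<noteq> confs n"
    using X(2) unfolding labelling_def by (auto simp: card_image dest: sym)
  then obtain z where z: "z \<in> confs n - \<pi> ` X" "lower n (insert z (\<pi> ` X))"
    using lower_insert X(2) unfolding labelling_def by metis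
  let ?p = "\<pi>(x := z)"
  have im: "?p ` insert x X = insert z (\<pi> ` X)" using x by auto
  have "inj_on ?p (insert x X)" using X(2) x z(1) unfolding labelling_def by (auto simp: inj_on_def)
  then have "labelling n (insert x X) ?p" unfolding labelling_def im using z(2) by simp
  moreover have "\<not> ?p x \<le> ?p y" if y: "y \<in> X" for y
  proof -
    have "weight n (\<pi> y) \<le> weight n z" "\<pi> y \<in> confs n"
      using X(2) z(1) y unfolding labelling_def lower_def by auto
    then have "\<not> z \<le> \<pi> y" using not_le_if_weight_le[of z n "\<pi> y"] z(1) y by auto
    then show ?thesis using y x by auto
  qed
  ultimately show ?thesis using x by (intro exI[of _ ?p]) auto
qed

text \<open>Meant for points that \<open>c\<close> lists backwards along a map: the steps from
  \<open>c (Suc i)\<close> to \<open>c i\<close> and the closing step from \<open>c 0\<close> to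
  \<open>c (k - 1)\<close> do not ascend. The bound by the last weight later identifies a label of
  weight \<open>n - 1\<close>.\<close>

lemma extend_labelling_cycle:
  assumes X: "X \<subseteq> confs n" "X \<noteq> {}" "labelling n X \<pi>"
    and c: "inj_on c {..<k}" "c ` {..<k} \<subseteq> confs n - X" "X \<union> c ` {..<k} \<noteq> confs n" "2 \<le> k"
  shows "\<exists>\<pi>'. labelling n (X \<union> c ` {..<k}) \<pi>' \<and> (\<forall>x\<in>X. \<pi>' x = \<pi> x) \<and>
    (\<forall>i. Suc i < k \<longrightarrow> \<not> \<pi>' (c (Suc i)) \<le> \<pi>' (c i)) \<and> \<not> \<pi>' (c 0) \<le> \<pi>' (c (k - 1)) \<and>
    (\<forall>x\<in>X \<union> c ` {..<k}. weight n (\<pi>' x) \<le> weight n (\<pi>' (c (k - 1))))"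
proof -
  have "card (X \<union> c ` {..<k}) < card (confs n)"
    using X(1) c(2,3) finite_confs by (intro psubset_card_mono) auto
  moreover have "card (X \<union> c ` {..<k}) = card X + k"
    using c(1,2) X(1) finite_subset[OF X(1) finite_confs]
    by (subst card_Un_disjoint) (auto simp: card_image)
  moreover have "card (\<pi> ` X) = card X" using X(3) unfolding labelling_def by (simp add: card_image)
  ultimately have card: "card (\<pi> ` X) + k < card (confs n)" by simp
  obtain y where y: "inj_on y {..<k}" "y ` {..<k} \<subseteq> confs n - \<pi> ` X"
    "\<And>i j. i \<le> j \<Longrightarrow> j < k \<Longrightarrow> weight n (y i) \<le> weight n (y j)" "lower n (\<pi> ` X \<union> y ` {..<k})"
    "\<not> y 0 \<le> y (k - 1)"
    using cyclic_labels[OF _ _ c(4) card] X(2,3) unfolding labelling_def by blast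
  define p where "p x = (if x \<in> X then \<pi> x else y (the_inv_into {..<k} c x))" for x
  have pX: "p x = \<pi> x" if "x \<in> X" for x using that by (simp add: p_def)
  have pc: "p (c i) = y i" if "i < k" for i
    using that c(1,2) by (auto simp: p_def the_inv_into_f_f)
  have "p ` X = \<pi> ` X" using pX by auto
  moreover have pim: "p ` c ` {..<k} = y ` {..<k}" unfolding image_image using pc by (intro image_cong) auto
  ultimately have im: "p ` (X \<union> c ` {..<k}) = \<pi> ` X \<union> y ` {..<k}" by (simp add: image_Un)
  have "inj_on p X" using X(3) pX unfolding labelling_def by (simp cong: inj_on_cong)
  moreover have "inj_on p (c ` {..<k})"
    by (rule inj_on_imageI) (use y(1) pc in \<open>simp add: inj_on_def\<close>)
  moreover have "p ` X \<inter> p ` c ` {..<k} = {}" unfolding pim \<open>p ` X = \<pi> ` X\<close> using y(2) by auto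
  ultimately have inj: "inj_on p (X \<union> c ` {..<k})" unfolding inj_on_Un by blast
  have "\<not> p (c (Suc i)) \<le> p (c i)" if i: "Suc i < k" for i
  proof -
    have "y (Suc i) \<noteq> y i" using inj_onD[OF y(1), of "Suc i" i] i by auto
    moreover have "y (Suc i) \<in> confs n" "y i \<in> confs n" using y(2) i by (auto simp: image_subset_iff)
    ultimately show ?thesis
      using not_le_if_weight_le[of "y (Suc i)" n "y i"] y(3)[of i "Suc i"] i pc[of i] pc[of "Suc i"] by simp
  qed
  moreover have "weight n (p x) \<le> weight n (p (c (k - 1)))" if x: "x \<in> X \<union> c ` {..<k}" for x
  proof (cases "x \<in> X")
    case True
    have "y (k - 1) \<in> confs n - \<pi> ` X" using y(2) c(4) by (auto simp: image_subset_iff)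
    then have "weight n (\<pi> x) \<le> weight n (y (k - 1))"
      using True X(3) unfolding labelling_def lower_def by blast
    then show ?thesis using True c(4) pX[of x] pc[of "k - 1"] by simp
  next
    case False
    then obtain i where "i < k" "x = c i" using x by auto
    then show ?thesis using y(3)[of i "k - 1"] pc[of i] pc[of "k - 1"] by simp
  qed
  moreover have "\<not> p (c 0) \<le> p (c (k - 1))" using y(5) pc c(4) by simp
  ultimately show ?thesis using inj im y(4) pX unfolding labelling_def by (intro exI[of _ p]) simp
qed

section \<open>Cycles, and labellings of closed sets without ascents\<close>

text \<open>Iteration in a finite set repeats a value, and the least period of that value gives a
  cycle. It is listed backwards along \<open>f\<close>, the order in which labels are handed
  out.\<close>

lemma periodic_orbit:
  assumes "finite S" "S \<noteq> {}" "f ` S \<subseteq> S"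
  shows "\<exists>c k. 0 < k \<and> inj_on c {..<k} \<and> c ` {..<k} \<subseteq> S \<and>
    (\<forall>i. Suc i < k \<longrightarrow> f (c (Suc i)) = c i) \<and> f (c 0) = c (k - 1)"
proof -
  obtain x where x: "x \<in> S" using assms(2) by blast
  have iter: "(f ^^ i) a \<in> S" if "a \<in> S" for i a using that assms(3) by (induction i) auto
  have "\<not> inj (\<lambda>i. (f ^^ i) x)"
    using iter[OF x] assms(1) by (metis finite_subset image_subsetI infinite_UNIV_nat finite_imageD)
  then obtain i j where ij: "i < j" "(f ^^ i) x = (f ^^ j) x"
    unfolding inj_def by (metis linorder_neqE_nat)
  define z where "z = (f ^^ i) x"
  have zS: "z \<in> S" using iter x z_def by simp
  have "(f ^^ (j - i)) z = (f ^^ (j - i + i)) x" unfolding z_def by (simp only: funpow_add o_apply)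
  then have per: "0 < j - i \<and> (f ^^ (j - i)) z = z" using ij by (simp add: z_def)
  define k where "k = (LEAST m. 0 < m \<and> (f ^^ m) z = z)"
  have k: "0 < k" "(f ^^ k) z = z" using LeastI[of "\<lambda>m. 0 < m \<and> (f ^^ m) z = z", OF per] k_def by auto
  have min: "(f ^^ m) z \<noteq> z" if "0 < m" "m < k" for m
    using not_less_Least that k_def by blast
  have neq: "(f ^^ a) z \<noteq> (f ^^ b) z" if ab: "a < b" "b < k" for a b
  proof
    assume eq: "(f ^^ a) z = (f ^^ b) z"
    \<comment> \<open>Applying \<open>f\<close> another \<open>k - b\<close> times would return to
      \<open>z\<close> after fewer than \<open>k\<close> steps.\<close>
    have "(f ^^ (k - b + a)) z = (f ^^ (k - b + b)) z" by (simp only: funpow_add o_apply eq)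
    moreover have "k - b + a < k" using ab by simp
    ultimately show False using min[of "k - b + a"] k ab by simp
  qed
  then have inj: "inj_on (\<lambda>i. (f ^^ i) z) {..<k}"
    by (intro inj_onI) (metis lessThan_iff linorder_neqE_nat)
  define c where "c i = (f ^^ (k - 1 - i)) z" for i
  have "inj_on c {..<k}"
  proof (rule inj_onI)
    fix a b assume ab: "a \<in> {..<k}" "b \<in> {..<k}" "c a = c b"
    then have "k - 1 - a = k - 1 - b" using inj_onD[OF inj, of "k - 1 - a" "k - 1 - b"] by (simp add: c_def)
    then show "a = b" using ab by auto
  qed
  moreover have "c ` {..<k} \<subseteq> S" using iter zS by (auto simp: c_def)
  moreover have "f (c (Suc i)) = c i" if "Suc i < k" for i
  proof -
    have "k - 1 - i = Suc (k - 1 - Suc i)" using that by simp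
    then show ?thesis unfolding c_def by simp
  qed
  moreover have "f (c 0) = c (k - 1)"
    using k by (cases k) (auto simp: c_def)
  ultimately show ?thesis using k(1) by blast
qed

text \<open>For a point that is not fixed, this says that the conjugate of \<open>f\<close> under
  \<open>\<pi>\<close> has a decreasing arc out of \<open>\<pi> x\<close>.\<close>

definition descends :: "(conf \<Rightarrow> conf) \<Rightarrow> (conf \<Rightarrow> conf) \<Rightarrow> conf \<Rightarrow> bool" where
  "descends f \<pi> x \<longleftrightarrow> f x = x \<or> \<not> \<pi> x \<le> \<pi> (f x)"

text \<open>Induction on the number of unlabelled points of \<open>D\<close>. A point that is fixed
  or has a labelled image comes next; if there is none, \<open>f\<close> maps the unlabelled points
  to themselves and a whole cycle of them comes next. As \<open>D\<close> is not everything, the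
  spare label required for a cycle is always there.\<close>

lemma complete_labelling:
  assumes D: "D \<subseteq> confs n" "f ` D \<subseteq> D" "D \<noteq> confs n"
    and X: "X \<noteq> {}" "X \<subseteq> D" "f ` X \<subseteq> X" "labelling n X \<pi>" "\<forall>x\<in>X. descends f \<pi> x"
  shows "\<exists>\<pi>. labelling n D \<pi> \<and> (\<forall>x\<in>D. descends f \<pi> x)"
  using X
proof (induction "card (D - X)" arbitrary: X \<pi> rule: less_induct)
  case less
  have finD: "finite D" using D(1) finite_confs finite_subset by blast
  have IH: "\<exists>\<pi>. labelling n D \<pi> \<and> (\<forall>x\<in>D. descends f \<pi> x)"
    if Z: "Z \<noteq> {}" "Z \<subseteq> D" "Z \<inter> X = {}" "f ` Z \<subseteq> X \<union> Z" "labelling n (X \<union> Z) \<rho>"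
      "\<forall>x\<in>X. \<rho> x = \<pi> x" "\<forall>x\<in>Z. descends f \<rho> x" for Z \<rho>
  proof (rule less.hyps[of "X \<union> Z" \<rho>])
    show "card (D - (X \<union> Z)) < card (D - X)"
      using Z(1,2,3) finD by (intro psubset_card_mono) auto
    \<comment> \<open>\<open>X\<close> is closed under \<open>f\<close> and keeps its labels, so
      nothing changes there.\<close>
    show "\<forall>x\<in>X \<union> Z. descends f \<rho> x"
      using Z(6,7) less.prems(3,5) by (auto simp: descends_def image_subset_iff)
  qed (use Z less.prems in auto)
  show ?case
  proof (cases "X = D")
    case True
    then show ?thesis using less.prems by blast
  next
    case False
    show ?thesis
    proof (cases "\<exists>x\<in>D - X. f x \<in> insert x X")
      case True
      then obtain x where x: "x \<in> D - X" "f x \<in> insert x X" by blast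
      obtain \<rho> where \<rho>: "labelling n (insert x X) \<rho>" "\<forall>z\<in>X. \<rho> z = \<pi> z" "\<forall>z\<in>X. \<not> \<rho> x \<le> \<rho> z"
        using extend_labelling_point[of X n \<pi> x] less.prems x D(1) by blast
      have "descends f \<rho> x" using x(2) \<rho>(3) unfolding descends_def by blast
      then show ?thesis using x \<rho> by (intro IH[of "{x}" \<rho>]) auto
    next
      case no: False
      let ?S = "D - X"
      have "f ` ?S \<subseteq> ?S" using no D(2) by blast
      moreover have "?S \<noteq> {}" using False less.prems(2) by blast
      ultimately obtain c k where c: "0 < k" "inj_on c {..<k}" "c ` {..<k} \<subseteq> ?S"
        "\<And>i. Suc i < k \<Longrightarrow> f (c (Suc i)) = c i" "f (c 0) = c (k - 1)"
        using periodic_orbit[of ?S f] finD by blast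
      have cS: "c i \<in> ?S" if "i < k" for i using that c(3) by blast
      have "k \<noteq> 1" using no c(5) cS[of 0] by auto
      then have k: "2 \<le> k" using c(1) by simp
      have sub: "X \<union> c ` {..<k} \<subseteq> D" using less.prems(2) c(3) by blast
      obtain \<rho> where \<rho>: "labelling n (X \<union> c ` {..<k}) \<rho>" "\<forall>x\<in>X. \<rho> x = \<pi> x"
        "\<And>i. Suc i < k \<Longrightarrow> \<not> \<rho> (c (Suc i)) \<le> \<rho> (c i)" "\<not> \<rho> (c 0) \<le> \<rho> (c (k - 1))"
        using extend_labelling_cycle[of X n \<pi> c k] less.prems c(2,3) k sub D(1,3) by blast
      have im: "f (c i) \<in> c ` {..<k} \<and> descends f \<rho> (c i)" if "i < k" for i
        using that c(1,4,5) \<rho>(3,4) by (cases i) (auto simp: descends_def)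
      show ?thesis
        using c(1,3) \<rho>(1,2) im by (intro IH[of "c ` {..<k}" \<rho>]) auto
    qed
  qed
qed

text \<open>The orbits \<open>{x, g x}\<close> have two elements each and are removed one at a
  time.\<close>

lemma even_card_involution:
  assumes "finite A" "\<And>x. x \<in> A \<Longrightarrow> g x \<in> A \<and> g x \<noteq> x \<and> g (g x) = x"
  shows "even (card A)"
  using assms
proof (induction "card A" arbitrary: A rule: less_induct)
  case less
  show ?case
  proof (cases "A = {}")
    case False
    then obtain x where x: "x \<in> A" by blast
    let ?B = "A - {x, g x}"
    have "card {x, g x} = 2" using less.prems(2)[OF x] by (auto simp: card_2_iff)
    then have card: "card A = card ?B + 2"
      using x less.prems(1) less.prems(2)[OF x] card_mono[of A "{x, g x}"] by (simp add: card_Diff_subset)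
    have "even (card ?B)"
    proof (rule less.hyps)
      show "card ?B < card A" using card by simp
      show "finite ?B" using less.prems(1) by simp
      show "g y \<in> ?B \<and> g y \<noteq> y \<and> g (g y) = y" if "y \<in> ?B" for y
        using that less.prems(2)[of y] less.prems(2)[of x] x by auto
    qed
    then show ?thesis using card by simp
  qed simp
qed

text \<open>The all-zero label has weight 0, so it forms an initial segment on its own.\<close>

lemma labelling_singleton: "\<exists>\<pi>. labelling n {p} \<pi>"
proof
  let ?z = "\<lambda>i\<in>{1..n}. 0 :: nat"
  show "labelling n {p} (\<lambda>_. ?z)"
    unfolding labelling_def lower_def by (auto simp: confs_def weight_def)
qed

lemma closed_set_labelling:
  assumes "D \<subseteq> confs n" "f ` D \<subseteq> D" "D \<noteq> confs n" "{p} \<subseteq> D" "f p = p"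
  shows "\<exists>\<pi>. labelling n D \<pi> \<and> (\<forall>x\<in>D. descends f \<pi> x)"
proof -
  obtain \<pi> where "labelling n {p} \<pi>" using labelling_singleton by blast
  then show ?thesis
    using assms(5) by (intro complete_labelling[OF assms(1-3) _ assms(4)]) (simp_all add: descends_def)
qed

section \<open>Labellings of all configurations\<close>

text \<open>Describes the one ascent that may remain. The two inequalities keep the label of
  \<open>f (f b)\<close> apart from those of \<open>b\<close> and \<open>f b\<close>, so that a
  decreasing arc can leave the all-ones configuration without meeting the label of
  \<open>b\<close>.\<close>

definition exceptional :: "nat \<Rightarrow> (conf \<Rightarrow> conf) \<Rightarrow> (conf \<Rightarrow> conf) \<Rightarrow> conf \<Rightarrow> bool" where
  "exceptional n f \<pi> b \<longleftrightarrow> b \<in> confs n \<and> Suc (weight n (\<pi> b)) = n \<and> \<pi> (f b) = ones n \<and>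
     f (f b) \<noteq> b \<and> f (f b) \<noteq> f b"

text \<open>Nothing but possibly \<open>r\<close> maps to \<open>r\<close>, so the other
  configurations are closed under \<open>f\<close> and can be labelled with one label in reserve.
  Then \<open>r\<close> comes last, after its image unless it is fixed.\<close>

lemma last_point_labelling:
  assumes f: "f \<in> F n" and p: "p \<in> confs n" "f p = p"
    and r: "r \<in> confs n" "r \<noteq> p" "\<And>x. x \<in> confs n \<Longrightarrow> f x = r \<Longrightarrow> x = r"
  shows "\<exists>\<pi>. labelling n (confs n) \<pi> \<and> (\<forall>x\<in>confs n. descends f \<pi> x)"
proof -
  have fV: "f x \<in> confs n" if "x \<in> confs n" for x using f that unfolding F_def by auto
  let ?D = "confs n - {r}"
  have "f ` ?D \<subseteq> ?D" "?D \<noteq> confs n" "{p} \<subseteq> ?D" using fV r p(1) by blast+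
  then obtain \<pi> where \<pi>: "labelling n ?D \<pi>" "\<forall>x\<in>?D. descends f \<pi> x"
    using closed_set_labelling[of ?D n f p] p(2) by blast
  obtain \<rho> where \<rho>: "labelling n (insert r ?D) \<rho>" "\<forall>z\<in>?D. \<rho> z = \<pi> z" "\<forall>z\<in>?D. \<not> \<rho> r \<le> \<rho> z"
    using extend_labelling_point[of ?D n \<pi> r] \<pi>(1) r(1) by blast
  have "descends f \<rho> x" if x: "x \<in> confs n" for x
  proof (cases "x = r")
    case True
    then show ?thesis using \<rho>(3) fV[OF x] by (auto simp: descends_def)
  next
    case False
    then have "x \<in> ?D" "f x \<in> ?D" using x r(3) fV by blast+
    then show ?thesis using \<pi>(2) \<rho>(2) by (auto simp: descends_def)
  qed
  moreover have "insert r ?D = confs n" using r(1) by auto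
  ultimately show ?thesis using \<rho>(1) by auto
qed

text \<open>Everything outside one cycle \<open>C\<close> of length at least 3 is labelled first,
  then \<open>C\<close> without a point \<open>t\<close>, then \<open>t\<close>. The assumption
  \<open>0 < n\<close> makes the number of configurations even, as the parity argument
  requires.\<close>

lemma permutation_labelling:
  assumes f: "f \<in> F n" and inj: "inj_on f (confs n)" and n: "0 < n"
    and p: "p \<in> confs n" "f p = p" "\<And>x. x \<in> confs n \<Longrightarrow> f x = x \<Longrightarrow> x = p"
  shows "\<exists>\<pi> b. labelling n (confs n) \<pi> \<and> exceptional n f \<pi> b \<and>
    (\<forall>x\<in>confs n - {b}. descends f \<pi> x)"
proof -
  let ?V = "confs n"
  have fV: "f x \<in> ?V" if "x \<in> ?V" for x using f that unfolding F_def by auto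
  \<comment> \<open>The points on cycles of length at least 3. Without them, \<open>f\<close> would
    pair off the \<open>2 ^ n - 1\<close> configurations other than \<open>p\<close>.\<close>
  let ?S = "{x \<in> ?V. f (f x) \<noteq> x}"
  have "?S \<noteq> {}"
  proof
    assume S: "?S = {}"
    have "even (card (?V - {p}))"
    proof (rule even_card_involution)
      show "f x \<in> ?V - {p} \<and> f x \<noteq> x \<and> f (f x) = x" if "x \<in> ?V - {p}" for x
        using that S p fV by (metis (mono_tags, lifting) Diff_iff empty_Collect_eq insertI1 singletonD)
    qed (simp add: finite_confs)
    moreover have "Suc (card (?V - {p})) = 2 ^ n"
      using card_Suc_Diff1[OF finite_confs p(1)] by (simp add: card_confs)
    moreover have "even ((2::nat) ^ n)" using n by simp
    ultimately show False by (metis even_Suc)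
  qed
  moreover have "f ` ?S \<subseteq> ?S" using fV inj by (auto dest: inj_onD)
  ultimately obtain c k where c: "0 < k" "inj_on c {..<k}" "c ` {..<k} \<subseteq> ?S"
      "\<And>i. Suc i < k \<Longrightarrow> f (c (Suc i)) = c i" "f (c 0) = c (k - 1)"
    using periodic_orbit[of ?S f] finite_subset[OF _ finite_confs, of ?S] by blast
  have cS: "c i \<in> ?V" "f (f (c i)) \<noteq> c i" if "i < k" for i using that c(3) by auto
  have c_eq: "c i = c j \<longleftrightarrow> i = j" if "i < k" "j < k" for i j
    using that c(2) by (auto dest: inj_onD)
  have "k \<noteq> 1" using cS[of 0] c(1,5) by auto
  moreover have "k \<noteq> 2" using cS(2)[of 0] c(5) c(4)[of 0] by auto
  ultimately have k3: "3 \<le> k" using c(1) by simp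
  then obtain m where k: "k = Suc (Suc (Suc m))" by (intro that[of "k - 3"]) simp
  define C where "C = c ` {..<k}"
  have pC: "p \<notin> C" using c(3) p(2) by (auto simp: C_def)
  have CV: "C \<subseteq> ?V" using c(3) by (auto simp: C_def)
  \<comment> \<open>\<open>C\<close> contains a preimage of each of its points, so by injectivity
    nothing outside maps into it.\<close>
  have fC: "\<exists>y\<in>C. f y = z" if zC: "z \<in> C" for z
  proof -
    obtain i where i: "i < k" "z = c i" using zC unfolding C_def by blast
    show ?thesis
    proof (cases "Suc i < k")
      case True
      then show ?thesis using c(4) i C_def by blast
    next
      case False
      then have "i = k - 1" using i by simp
      then show ?thesis using c(1,5) i C_def by blast
    qed
  qed
  let ?D = "?V - C"
  have fD: "f x \<in> ?D" if x: "x \<in> ?D" for x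
  proof -
    have "f x \<notin> C"
    proof
      assume "f x \<in> C"
      then obtain y where "y \<in> C" "f y = f x" using fC by blast
      then show False using x CV inj by (metis DiffD1 DiffD2 inj_onD subsetD)
    qed
    then show ?thesis using x fV by simp
  qed
  have "c 0 \<in> C" using c(1) C_def by blast
  then have "f ` ?D \<subseteq> ?D" "?D \<noteq> ?V" "{p} \<subseteq> ?D" using CV fD p(1) pC by blast+
  then obtain \<pi> where \<pi>: "labelling n ?D \<pi>" "\<forall>x\<in>?D. descends f \<pi> x"
    using closed_set_labelling[of ?D n f p] p(2) by blast
  \<comment> \<open>Placing \<open>b\<close> before \<open>t = f b\<close> leaves the all-ones label to \<open>t\<close> and makes \<open>b\<close> the last point
    of the chain whose closing step \<open>f (c 0) = b\<close> must not ascend.\<close>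
  define t b where "t = c (Suc m)" and "b = c (Suc (Suc m))"
  define d where "d i = (if i \<le> m then c i else b)" for i
  have tC: "t \<in> C" by (auto simp: t_def C_def k)
  have dim: "d ` {..<Suc (Suc m)} = C - {t}"
  proof -
    have "{..<Suc (Suc m)} = insert (Suc m) {..m}" by auto
    then have "d ` {..<Suc (Suc m)} = insert b (c ` {..m})" by (auto simp: d_def)
    also have "\<dots> = c ` insert (Suc (Suc m)) {..m}" by (simp add: b_def)
    also have "insert (Suc (Suc m)) {..m} = {..<k} - {Suc m}" by (auto simp: k)
    also have "c ` \<dots> = C - {t}"
      using inj_on_image_set_diff[OF c(2), of "{..<k}" "{Suc m}"] by (simp add: C_def t_def k)
    finally show ?thesis .
  qed
  have dinj: "inj_on d {..<Suc (Suc m)}"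
    by (rule inj_onI) (auto simp: d_def b_def c_eq k split: if_splits)
  have Un: "?D \<union> d ` {..<Suc (Suc m)} = ?V - {t}" using dim tC CV by auto
  have tV: "t \<in> ?V" using tC CV by blast
  have "?D \<noteq> {}" using p(1) pC by blast
  moreover have "d ` {..<Suc (Suc m)} \<subseteq> ?V - ?D" using dim CV by blast
  moreover have "?D \<union> d ` {..<Suc (Suc m)} \<noteq> ?V" using Un tV by blast
  ultimately obtain \<rho> where \<rho>: "labelling n (?V - {t}) \<rho>" "\<forall>x\<in>?D. \<rho> x = \<pi> x"
    "\<And>i. Suc i < Suc (Suc m) \<Longrightarrow> \<not> \<rho> (d (Suc i)) \<le> \<rho> (d i)" "\<not> \<rho> (d 0) \<le> \<rho> (d (Suc m))"
    "\<forall>x\<in>?V - {t}. weight n (\<rho> x) \<le> weight n (\<rho> (d (Suc m)))"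
    using extend_labelling_cycle[of ?D n \<pi> d "Suc (Suc m)"] \<pi>(1) dinj unfolding Un by auto
  have "insert t (?V - {t}) = ?V" using tV by blast
  then obtain \<tau> where \<tau>: "labelling n ?V \<tau>" "\<forall>x\<in>?V - {t}. \<tau> x = \<rho> x"
    "\<forall>x\<in>?V - {t}. \<not> \<tau> t \<le> \<tau> x"
    using extend_labelling_point[of "?V - {t}" n \<rho> t] \<rho>(1) tV by auto
  have surj: "\<exists>x\<in>?V. \<tau> x = y" if "y \<in> ?V" for y
    using labelling_bij[OF \<tau>(1)] that unfolding bij_betw_def by (metis imageE)
  \<comment> \<open>Some point carries the all-ones label, which is above the label of
    \<open>t\<close>; no point other than \<open>t\<close> has a label above it.\<close>
  have \<tau>t: "\<tau> t = ones n"
  proof -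
    obtain x where x: "x \<in> ?V" "\<tau> x = ones n" using surj ones_in_confs by blast
    then have "\<tau> t \<le> \<tau> x" using le_ones labelling_in_confs[OF \<tau>(1) tV] by simp
    then have "x = t" using \<tau>(3) x by blast
    then show ?thesis using x by simp
  qed
  have bV: "b \<in> ?V" using cS by (simp add: b_def k)
  have bt: "b \<noteq> t" using c_eq by (simp add: b_def t_def k)
  have cV: "c i \<in> ?V - {t}" if "i \<le> m" for i using that cS[of i] c_eq[of i "Suc m"] by (auto simp: t_def k)
  have \<tau>d: "\<tau> (d i) = \<rho> (d i)" for i using \<tau>(2) cV bV bt by (auto simp: d_def)
  have db: "d (Suc m) = b" by (simp add: d_def)
  have fb: "f b = t" using c(4)[of "Suc m"] by (simp add: b_def t_def k)
  have ft: "f t = c m" using c(4)[of m] by (simp add: t_def k)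
  have "Suc (weight n (\<tau> b)) = n"
  proof (rule antisym)
    have "\<tau> b \<noteq> ones n" using \<tau>t labelling_bij[OF \<tau>(1)] bV tV bt
      unfolding bij_betw_def by (metis inj_onD)
    then show "Suc (weight n (\<tau> b)) \<le> n"
      using weight_strict_mono[of "\<tau> b" n "ones n"] labelling_in_confs[OF \<tau>(1) bV] ones_in_confs le_ones weight_ones
      by simp
    \<comment> \<open>A label of weight \<open>n - 1\<close> carried by a point other than
      \<open>t\<close>; among those points \<open>b\<close> has maximal weight.\<close>
    let ?y = "(ones n)(1 := 0)"
    have one: "1 \<in> {1..n}" using n by simp
    have o1: "ones n 1 = 1" using n by (simp add: ones_def)
    have "?y \<in> ?V" using fun_upd_in_confs[OF ones_in_confs one] by simp
    then obtain x where x: "x \<in> ?V" "\<tau> x = ?y" using surj by blast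
    have "x \<noteq> t" using x(2) \<tau>t o1 by (metis fun_upd_same zero_neq_one)
    then have "weight n ?y \<le> weight n (\<tau> b)" using x \<rho>(5) \<tau>(2) bV bt db by (metis DiffI singletonD)
    then show "n \<le> Suc (weight n (\<tau> b))" using weight_fun_upd_0[of 1 n "ones n"] one o1 weight_ones by simp
  qed
  moreover have "f (f b) \<noteq> b" "f (f b) \<noteq> f b"
    using fb ft c_eq by (simp_all add: b_def t_def k)
  ultimately have "exceptional n f \<tau> b"
    unfolding exceptional_def using bV fb \<tau>t by simp
  moreover have "descends f \<tau> x" if x: "x \<in> ?V - {b}" for x
  proof (cases "x \<in> C")
    case False
    then have "x \<in> ?D" "f x \<in> ?D" using x fD by auto
    moreover have "\<tau> y = \<pi> y" if y: "y \<in> ?D" for y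
    proof -
      have "y \<in> ?V - {t}" using y tC by blast
      then show ?thesis using y \<rho>(2) \<tau>(2) by simp
    qed
    ultimately show ?thesis using \<pi>(2) by (simp add: descends_def)
  next
    case True
    then obtain i where i: "i < k" "x = c i" using C_def by auto
    moreover have "i \<noteq> Suc (Suc m)" using i x by (auto simp: b_def)
    \<comment> \<open>The closing step from \<open>c 0\<close> to \<open>b\<close>, the step out of
      \<open>t\<close>, which was labelled after its image, and the steps between consecutive
      entries of \<open>d\<close>.\<close>
    ultimately consider "i = 0" | "i = Suc m" | j where "i = Suc j" "Suc j \<le> m"
      using k by (cases i) fastforce+
    then show ?thesis
    proof cases
      case 1
      then have "f x = b" "x = d 0" using i c(5) by (auto simp: b_def k d_def)
      then show ?thesis using \<rho>(4) \<tau>d[of 0] \<tau>d[of "Suc m"] db by (simp add: descends_def)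
    next
      case 2
      then have "x = t" using i t_def by simp
      then show ?thesis using ft \<tau>(3) cV[of m] by (simp add: descends_def)
    next
      case 3
      then have "x = d (Suc j)" "f x = d j" using i c(4)[of j] by (auto simp: d_def k)
      then show ?thesis using \<rho>(3)[of j] 3 \<tau>d[of j] \<tau>d[of "Suc j"] by (simp add: descends_def)
    qed
  qed
  ultimately show ?thesis using \<tau>(1) by blast
qed

text \<open>On a finite set, a map that is not injective misses a point; a second fixed point of an
  injective map has only itself as preimage. Either kind of point can be placed last.\<close>

lemma descending_labelling:
  assumes f: "f \<in> F n" and p: "p \<in> confs n" "f p = p"
  shows "\<exists>\<pi>. labelling n (confs n) \<pi> \<and> ((\<forall>x\<in>confs n. descends f \<pi> x) \<or>
    (\<exists>b. exceptional n f \<pi> b \<and> (\<forall>x\<in>confs n - {b}. descends f \<pi> x)))"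
proof -
  have fV: "f ` confs n \<subseteq> confs n" using f unfolding F_def by auto
  show ?thesis
  proof (cases "inj_on f (confs n)")
    case False
    then have "f ` confs n \<noteq> confs n"
      using eq_card_imp_inj_on[OF finite_confs, of f n] by auto
    then obtain r where r: "r \<in> confs n" "r \<notin> f ` confs n" using fV by blast
    then have "r \<noteq> p" using p by force
    then show ?thesis using last_point_labelling[OF f p r(1)] r(2) by blast
  next
    case inj: True
    show ?thesis
    proof (cases "\<exists>r\<in>confs n. f r = r \<and> r \<noteq> p")
      case True
      then obtain r where "r \<in> confs n" "f r = r" "r \<noteq> p" by blast
      then show ?thesis using last_point_labelling[OF f p, of r] inj by (metis inj_onD)
    next
      case False
      show ?thesis
      \<comment> \<open>For \<open>n = 0\<close> the parity argument fails, but \<open>p\<close> is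
        the only configuration.\<close>
      proof (cases "n = 0")
        case True
        then have "card (confs n) = 1" by (simp add: card_confs)
        then have "confs n = {p}" using p(1) by (metis card_1_singletonE singletonD)
        then show ?thesis using labelling_singleton[of n p] p(2) by (auto simp: descends_def)
      next
        case n: False
        then show ?thesis using permutation_labelling[OF f inj _ p] False by blast
      qed
    qed
  qed
qed

section \<open>Conjugation by a labelling\<close>

text \<open>\<open>h\<close> is the conjugate of \<open>f\<close> by \<open>\<pi>\<close>, and
  \<open>\<pi>\<close> itself is the isomorphism of synchronous graphs.\<close>

lemma relabel:
  assumes f: "f \<in> F n" and \<pi>: "bij_betw \<pi> (confs n) (confs n)"
  shows "\<exists>h\<in>F n. dyn_iso n h f \<and> (\<forall>x\<in>confs n. h (\<pi> x) = \<pi> (f x))"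
proof -
  let ?V = "confs n"
  have fV: "f x \<in> ?V" if "x \<in> ?V" for x using f that unfolding F_def by auto
  have \<pi>V: "\<pi> x \<in> ?V" if "x \<in> ?V" for x using \<pi> that by (auto simp: bij_betw_def)
  have inj: "inj_on \<pi> ?V" using \<pi> by (auto simp: bij_betw_def)
  define h where "h = (\<lambda>x\<in>?V. \<pi> (f (the_inv_into ?V \<pi> x)))"
  have h\<pi>: "h (\<pi> x) = \<pi> (f x)" if "x \<in> ?V" for x
    using that \<pi>V inj by (simp add: h_def the_inv_into_f_f)
  have im: "\<pi> ` ?V = ?V" using \<pi> by (auto simp: bij_betw_def)
  have hV: "h x \<in> ?V" if x: "x \<in> ?V" for x
  proof -
    obtain z where z: "z \<in> ?V" "x = \<pi> z" using x im by blast
    show ?thesis unfolding z(2) h\<pi>[OF z(1)] by (intro \<pi>V fV z(1))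
  qed
  then have hF: "h \<in> F n" unfolding F_def by (auto simp: h_def)
  let ?i = "\<lparr>iso_verts = \<pi>, iso_arcs = map_prod \<pi> \<pi>, iso_head = snd, iso_tail = fst\<rparr>"
  have wf: "wf_digraph (sync_graph n f)"
    by unfold_locales (auto simp: sync_graph_def fV)
  have "inj_on (map_prod \<pi> \<pi>) (?V \<times> ?V)" using inj by (simp add: map_prod_inj_on)
  then have "inj_on (map_prod \<pi> \<pi>) {(x, f x) |x. x \<in> ?V}"
    by (rule inj_on_subset) (auto simp: fV)
  then have "pre_digraph.digraph_isomorphism (sync_graph n f) ?i"
    unfolding pre_digraph.digraph_isomorphism_def using wf inj by (simp add: sync_graph_def)
  moreover have "map_prod \<pi> \<pi> ` {(x, f x) |x. x \<in> ?V} = {(x, h x) |x. x \<in> ?V}"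
  proof -
    have "map_prod \<pi> \<pi> ` {(x, f x) |x. x \<in> ?V} = (\<lambda>x. (\<pi> x, h (\<pi> x))) ` ?V"
      unfolding setcompr_eq_image by (simp add: image_image h\<pi>)
    also have "\<dots> = (\<lambda>x. (x, h x)) ` \<pi> ` ?V" by (simp add: image_image)
    finally show ?thesis unfolding im by auto
  qed
  then have "sync_graph n h = app_iso ?i (sync_graph n f)"
    unfolding app_iso_def by (simp add: sync_graph_def with_proj_def im)
  ultimately have "digraph_iso (sync_graph n f) (sync_graph n h)"
    unfolding digraph_iso_def by blast
  then have "dyn_iso n h f" unfolding dyn_iso_def using digraph_iso_swap[OF wf] by blast
  then show ?thesis using hF h\<pi> by blast
qed

section \<open>Decreasing paths in the asynchronous graph\<close>

lemma add_unit_conf: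
  assumes "x \<in> confs n" "i \<in> {1..n}"
  shows "add_conf n x (unit_conf n i) = x(i := 1 - x i)"
proof
  fix j
  show "add_conf n x (unit_conf n i) j = (x(i := 1 - x i)) j"
  proof (cases "j \<in> {1..n}")
    case True
    then show ?thesis using confs_cases[OF assms(1) True] by (auto simp: add_conf_def unit_conf_def)
  next
    case False
    then have "x j = undefined" using assms(1) confs_outside by blast
    then show ?thesis using False assms(2) by (auto simp: add_conf_def)
  qed
qed

lemma async_graph_simps:
  "verts (async_graph n h) = confs n" "tail (async_graph n h) = fst" "head (async_graph n h) = snd"
  by (simp_all add: async_graph_def)

lemma async_arcI:
  assumes "x \<in> confs n" "i \<in> {1..n}" "h x i \<noteq> x i"
  shows "(x, x(i := 1 - x i)) \<in> arcs (async_graph n h)"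
  using assms add_unit_conf[OF assms(1,2)] by (force simp: async_graph_def)

lemma wf_async_graph: "wf_digraph (async_graph n h)"
proof
  fix a assume "a \<in> arcs (async_graph n h)"
  then obtain x i where a: "a = (x, add_conf n x (unit_conf n i))" "x \<in> confs n" "i \<in> {1..n}"
    by (auto simp: async_graph_def)
  have "x(i := 1 - x i) \<in> confs n"
    using fun_upd_in_confs[OF a(2,3)] confs_cases[OF a(2,3)] by auto
  then show "tail (async_graph n h) a \<in> verts (async_graph n h)"
    "head (async_graph n h) a \<in> verts (async_graph n h)"
    using a add_unit_conf[OF a(2,3)] by (simp_all add: async_graph_simps)
qed

text \<open>Induction on the weight, which drops along each arc. The set \<open>D\<close> lets a
  path avoid a prescribed configuration; the weight bound shows that no vertex is repeated.\<close>

lemma decreasing_path: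
  assumes D: "D \<subseteq> confs n"
    "\<And>x. x \<in> D \<Longrightarrow> h x = x \<or> (\<exists>i\<in>{1..n}. x i = 1 \<and> h x i = 0 \<and> x(i := 0) \<in> D)"
    and x: "x \<in> D"
  shows "\<exists>y\<in>fixed_points n h. \<exists>p. pre_digraph.apath (async_graph n h) x p y \<and>
    (\<forall>a\<in>set p. decreasing_arc a) \<and>
    (\<forall>v\<in>set (pre_digraph.awalk_verts (async_graph n h) x p). v \<in> D \<and> weight n v \<le> weight n x)"
  using x
proof (induction "weight n x" arbitrary: x rule: less_induct)
  case less
  interpret wf_digraph "async_graph n h" by (rule wf_async_graph)
  have xV: "x \<in> confs n" using less.prems D(1) by blast
  show ?case
  proof (cases "h x = x")
    case True
    then have "x \<in> fixed_points n h" "apath x [] x" using xV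
      by (simp_all add: fixed_points_def apath_Nil_iff async_graph_simps)
    moreover have "\<forall>v\<in>set (awalk_verts x []). v \<in> D \<and> weight n v \<le> weight n x" using less.prems by simp
    ultimately show ?thesis by (intro bexI[of _ x] exI[of _ "[]"]) simp_all
  next
    case False
    then obtain i where i: "i \<in> {1..n}" "x i = 1" "h x i = 0" "x(i := 0) \<in> D"
      using D(2) less.prems by blast
    let ?z = "x(i := 0)"
    have w: "weight n ?z < weight n x" using weight_fun_upd_0[of i n x] i by simp
    from less.hyps[OF w i(4)] obtain y p where y: "y \<in> fixed_points n h" and p: "apath ?z p y"
      "\<forall>a\<in>set p. decreasing_arc a"
      "\<forall>v\<in>set (awalk_verts ?z p). v \<in> D \<and> weight n v \<le> weight n ?z" by blast
    have "(x, ?z) \<in> arcs (async_graph n h)" using async_arcI[of x n i h] xV i by simp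
    moreover have "x \<notin> set (awalk_verts ?z p)" using p(3) w by auto
    ultimately have "apath x ((x, ?z) # p) y"
      using p(1) by (simp add: apath_Cons_iff async_graph_simps)
    moreover have "decreasing_arc (x, ?z)"
      using i(2) by (auto simp: decreasing_arc_def increasing_arc_def less_fun_def le_fun_def intro: exI[of _ i])
    moreover have "\<forall>v\<in>set (awalk_verts x ((x, ?z) # p)). v \<in> D \<and> weight n v \<le> weight n x"
      using p(3) w less.prems by (auto simp: async_graph_simps)
    ultimately show ?thesis using y p(2) by (intro bexI[of _ y] exI[of _ "(x, ?z) # p"]) auto
  qed
qed

lemma almost_decreasing_if_decreasing: "\<forall>a\<in>set p. decreasing_arc a \<Longrightarrow> almost_decreasing p"
  by (simp add: almost_decreasing_def filter_empty_conv)

section \<open>Almost decreasing paths from every configuration\<close>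

theorem theorem7:
  fixes n :: nat and f :: "conf \<Rightarrow> conf"
  assumes "f \<in> F n"
    and "fixed_points n f \<noteq> {}"
  shows "\<exists>h \<in> F n. dyn_iso n h f \<and>
    (\<forall>x \<in> confs n. \<exists>y \<in> fixed_points n h. \<exists>p.
       pre_digraph.apath (async_graph n h) x p y \<and> almost_decreasing p)"
proof -
  let ?V = "confs n"
  obtain p where "p \<in> ?V" "f p = p" using assms(2) by (auto simp: fixed_points_def)
  then obtain \<pi> where \<pi>: "labelling n ?V \<pi>" "(\<forall>x\<in>?V. descends f \<pi> x) \<or>
    (\<exists>b. exceptional n f \<pi> b \<and> (\<forall>x\<in>?V - {b}. descends f \<pi> x))"
    using descending_labelling[OF assms(1)] by blast
  note bij = labelling_bij[OF \<pi>(1)]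
  obtain h where h: "h \<in> F n" "dyn_iso n h f" "\<And>x. x \<in> ?V \<Longrightarrow> h (\<pi> x) = \<pi> (f x)"
    using relabel[OF assms(1) bij] by blast
  have fV: "f x \<in> ?V" if "x \<in> ?V" for x using assms(1) that unfolding F_def by auto
  have \<pi>V: "\<pi> x \<in> ?V" if "x \<in> ?V" for x using bij that by (auto simp: bij_betw_def)
  have \<pi>_eq: "\<pi> x = \<pi> y \<longleftrightarrow> x = y" if "x \<in> ?V" "y \<in> ?V" for x y
    using bij that unfolding bij_betw_def by (auto dest: inj_onD)
  have step: "h (\<pi> x) = \<pi> x \<or> (\<exists>i\<in>{1..n}. \<pi> x i = 1 \<and> h (\<pi> x) i = 0)"
    if x: "x \<in> ?V" "descends f \<pi> x" for x
  proof (cases "f x = x")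
    case False
    then have "\<not> \<pi> x \<le> \<pi> (f x)" using x unfolding descends_def by blast
    then show ?thesis using confs_not_leE[OF \<pi>V[OF x(1)] \<pi>V[OF fV[OF x(1)]]] h(3)[OF x(1)] by metis
  qed (use h(3) x in simp)
  have surj: "\<exists>z\<in>?V. x = \<pi> z" if "x \<in> ?V" for x
    using bij that unfolding bij_betw_def by blast
  have "\<exists>y \<in> fixed_points n h. \<exists>p. pre_digraph.apath (async_graph n h) x p y \<and> almost_decreasing p"
    if x: "x \<in> ?V" for x
    using \<pi>(2)
  proof
    assume all: "\<forall>x\<in>?V. descends f \<pi> x"
    have D: "h x = x \<or> (\<exists>i\<in>{1..n}. x i = 1 \<and> h x i = 0 \<and> x(i := 0) \<in> ?V)" if "x \<in> ?V" for x
      using surj[OF that] step all fun_upd_in_confs[OF that, of _ 0] by blast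
    show ?thesis
      using decreasing_path[OF subset_refl D x] almost_decreasing_if_decreasing by blast
  next
    assume "\<exists>b. exceptional n f \<pi> b \<and> (\<forall>x\<in>?V - {b}. descends f \<pi> x)"
    then obtain b where exc: "exceptional n f \<pi> b" and desc: "\<forall>x\<in>?V - {b}. descends f \<pi> x" by blast
    define \<beta> where "\<beta> = \<pi> b"
    have b: "b \<in> ?V" "f (f b) \<noteq> b" "f (f b) \<noteq> f b" using exc unfolding exceptional_def by auto
    have \<beta>: "\<beta> \<in> ?V" "Suc (weight n \<beta>) = n" "h \<beta> = ones n"
      using exc \<pi>V h(3) unfolding exceptional_def \<beta>_def by auto
    \<comment> \<open>Being neither \<open>\<beta>\<close> nor all ones, \<open>v\<close> weighs at
      most \<open>n - 1\<close>, the weight of \<open>\<beta>\<close>. So some \<open>i\<close> has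
      \<open>\<beta> i = 1\<close> and \<open>v i = 0\<close>, and clearing \<open>i\<close> in the
      all-ones configuration follows an arc that misses \<open>\<beta>\<close>.\<close>
    define v where "v = h (ones n)"
    have veq: "v = \<pi> (f (f b))"
      using exc h(3) fV b(1) unfolding v_def exceptional_def by metis
    then have vV: "v \<in> ?V" using \<pi>V fV b(1) by simp
    have "v \<noteq> \<beta>" using veq \<pi>_eq fV b by (simp add: \<beta>_def)
    moreover have "v \<noteq> ones n" using veq \<pi>_eq fV b exc unfolding exceptional_def by metis
    then have "weight n v < n"
      using weight_strict_mono[OF vV ones_in_confs le_ones[OF vV]] weight_ones by simp
    ultimately have "\<not> \<beta> \<le> v" using not_le_if_weight_le[OF \<beta>(1) vV] \<beta>(2) by simp
    then obtain i where i: "i \<in> {1..n}" "\<beta> i = 1" "v i = 0" using confs_not_leE[OF \<beta>(1) vV] by blast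
    have D: "h x = x \<or> (\<exists>i\<in>{1..n}. x i = 1 \<and> h x i = 0 \<and> x(i := 0) \<in> ?V - {\<beta>})"
      if x: "x \<in> ?V - {\<beta>}" for x
    proof (cases "x = ones n")
      case True
      have "x(i := 0) \<noteq> \<beta>" using i(2) by (metis fun_upd_same zero_neq_one)
      then show ?thesis using i x True fun_upd_in_confs[of x n i 0]
        by (intro disjI2 bexI[of _ i]) (auto simp: v_def ones_def)
    next
      case False
      obtain z where z: "z \<in> ?V" "x = \<pi> z" using surj x by blast
      then have "descends f \<pi> z" using desc x by (auto simp: \<beta>_def)
      then consider "h x = x" | j where "j \<in> {1..n}" "x j = 1" "h x j = 0" using step z by blast
      then show ?thesis
      proof cases
        case 2
        \<comment> \<open>Such an \<open>x\<close> weighs at most \<open>n - 1\<close>, so one arc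
          further down it is lighter than \<open>\<beta>\<close>.\<close>
        have "weight n x < n"
          using weight_strict_mono[of x n "ones n"] x False ones_in_confs le_ones weight_ones by simp
        then have "weight n (x(j := 0)) < weight n \<beta>" using weight_fun_upd_0[of j n x] 2 \<beta>(2) by simp
        then have "x(j := 0) \<noteq> \<beta>" by auto
        then show ?thesis using 2 x fun_upd_in_confs[of x n j 0] by auto
      qed simp
    qed
    note path = decreasing_path[where D = "?V - {\<beta>}" and h = h, OF Diff_subset D]
    show ?thesis
    proof (cases "x = \<beta>")
      case False
      then show ?thesis using path[of x] x almost_decreasing_if_decreasing by blast
    next
      case True
      interpret wf_digraph "async_graph n h" by (rule wf_async_graph)
      \<comment> \<open>As \<open>h \<beta>\<close> is all ones, a zero coordinate of
        \<open>\<beta>\<close> can be raised. The decreasing path from there avoids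
        \<open>\<beta>\<close>, so putting this arc in front repeats no vertex.\<close>
      have "ones n \<noteq> \<beta>" using \<beta>(2) weight_ones[of n] by auto
      then have "\<not> ones n \<le> \<beta>"
        using not_le_if_weight_le[OF ones_in_confs \<beta>(1)] \<beta>(2) weight_ones[of n] by auto
      then obtain j where j: "j \<in> {1..n}" "\<beta> j = 0" using confs_not_leE[OF ones_in_confs \<beta>(1)] by blast
      let ?z = "\<beta>(j := 1)"
      have z: "?z \<in> ?V - {\<beta>}"
        using fun_upd_in_confs[OF \<beta>(1) j(1)] j(2) by (metis Diff_iff fun_upd_same insertCI singletonD zero_neq_one)
      obtain y p where y: "y \<in> fixed_points n h" and p: "apath ?z p y" "\<forall>a\<in>set p. decreasing_arc a"
        "\<forall>v\<in>set (awalk_verts ?z p). v \<in> ?V - {\<beta>}"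
        using path[OF _ z] by blast
      have "(\<beta>, ?z) \<in> arcs (async_graph n h)"
        using async_arcI[OF \<beta>(1) j(1), of h] j \<beta>(3) by (simp add: ones_def)
      moreover have "\<beta> \<notin> set (awalk_verts ?z p)" using p(3) by blast
      ultimately have "apath x ((\<beta>, ?z) # p) y"
        using p(1) True by (simp add: apath_Cons_iff async_graph_simps)
      moreover have "almost_decreasing ((\<beta>, ?z) # p)"
        using p(2) almost_decreasing_if_decreasing[OF p(2)] by (simp add: almost_decreasing_def filter_empty_conv)
      ultimately show ?thesis using y by blast
    qed
  qed
  then show ?thesis using h(1,2) by blast
qed

end
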